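(* Let $X$ be an $n$-dimensional Musielak-Orlicz space. Then $e(X)\geq n+1$.
   Context: For a real finite-dimensional normed space $X$ with norm $\|\cdot\|$, a set $S\subset X$ is called equilateral if there is $p>0$ such that $\|x-y\|=p$ for all $x,y\in S$, $x\neq y$. The equilateral dimension $e(X)$ is the maximal cardinality of an equilateral set in $X$. A Young (or coordinate) function is a convex, left-continuous function $f:[0,\infty)\to[0,\infty]$ with $f(0)=0$, $\lim_{x\to\infty}f(x)=\infty$ and $f(x_0)\neq\infty$ for some $x_0>0$. For Young functions $f_1,\dots,f_n$ the set $$K=\Big\{(x_1,\dots,x_n)\in\mathbb{R}^n:\ \sum_{i=1}^n f_i(|x_i|)\leq 1\Big\}$$ is convex, symmetric, bounded and has non-empty interior, so $\|x\|=\inf\{\lambda>0: x\in\lambda K\}$ defines a norm on $\mathbb{R}^n$ (the Luxemburg norm). The space $(\mathbb{R}^n,\|\cdot\|)$ is called a Musielak-Orlicz space with coordinate functions $f_1,\dots,f_n$. *)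

theory Defs
  imports "HOL-Analysis.Analysis"
begin

text \<open>Young functions live on \<open>[0,\<infinity>)\<close>; they are represented by functions on all reals whose values at
  negative arguments are never used. In \<^typ>\<open>ennreal\<close> the convention \<open>0 * \<infinity> = 0\<close> makes the
  convexity inequality trivial for \<open>t = 0\<close> and \<open>t = 1\<close>.\<close>

definition young_function :: "(real \<Rightarrow> ennreal) \<Rightarrow> bool" where
  "young_function f \<longleftrightarrow>
     (\<forall>x\<ge>0. \<forall>y\<ge>0. \<forall>t\<in>{0..1}.
        f ((1 - t) * x + t * y) \<le> ennreal (1 - t) * f x + ennreal t * f y) \<and>
     (\<forall>x>0. continuous (at_left x) f) \<and>
     f 0 = 0 \<and>
     (f \<longlongrightarrow> \<infinity>) at_top \<and>
     (\<exists>x>0. f x \<noteq> \<infinity>)"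

definition musielak_orlicz_ball :: "('n::finite \<Rightarrow> real \<Rightarrow> ennreal) \<Rightarrow> (real ^ 'n) set" where
  "musielak_orlicz_ball f = {x. (\<Sum>i\<in>UNIV. f i \<bar>x $ i\<bar>) \<le> 1}"

definition luxemburg_norm :: "('n::finite \<Rightarrow> real \<Rightarrow> ennreal) \<Rightarrow> real ^ 'n \<Rightarrow> real" where
  "luxemburg_norm f x = Inf {l. l > 0 \<and> x \<in> (\<lambda>y. l *\<^sub>R y) ` musielak_orlicz_ball f}"

text \<open>The norm \<open>N\<close> is an explicit argument, since the norm of \<^typ>\<open>real ^ 'n\<close> is the Euclidean one.\<close>

definition equilateral :: "('a::real_vector \<Rightarrow> real) \<Rightarrow> 'a set \<Rightarrow> bool" where
  "equilateral N S \<longleftrightarrow> (\<exists>p>0. \<forall>x\<in>S. \<forall>y\<in>S. x \<noteq> y \<longrightarrow> N (x - y) = p)"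

text \<open>The supremum is taken in \<^typ>\<open>enat\<close>, so that it is meaningful without first knowing that the
  cardinalities of equilateral sets are bounded. When they are, it is the maximal cardinality.\<close>

definition equilateral_dim :: "('a::real_vector \<Rightarrow> real) \<Rightarrow> enat" where
  "equilateral_dim N = (SUP S\<in>{S. equilateral N S}. if finite S then enat (card S) else \<infinity>)"

end

theory Submission
  imports Defs
begin

text \<open>Let \<open>x\<^sub>i\<close> and \<open>a\<^sub>i\<close> be the largest points with \<open>f\<^sub>i(x\<^sub>i) \<le> 1\<close> and \<open>f\<^sub>i(a\<^sub>i) \<le> 1/2\<close>. The points
  \<open>a\<^sub>i e\<^sub>i\<close> have mutual distance 1: either \<open>f\<^sub>i(a\<^sub>i) = f\<^sub>j(a\<^sub>j) = 1/2\<close>, or one of the coordinates of the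
  difference has the largest possible value \<open>x\<^sub>k\<close>. The additional point is \<open>-s\<close> with
  \<open>0 \<le> s\<^sub>i \<le> x\<^sub>i - a\<^sub>i\<close>. It has distance 1 from all \<open>a\<^sub>i e\<^sub>i\<close> if, for some \<open>c\<close>, the sum of the
  \<open>f\<^sub>i(s\<^sub>i)\<close> is \<open>1 - c\<close> and, for every \<open>i\<close>, \<open>f\<^sub>i(a\<^sub>i + s\<^sub>i) - f\<^sub>i(s\<^sub>i)\<close> equals \<open>c\<close>, or is at most \<open>c\<close>
  and \<open>s\<^sub>i = x\<^sub>i - a\<^sub>i\<close>. By convexity these differences increase with \<open>s\<^sub>i\<close>, and a continuity argument
  in \<open>c \<in> [1/2, 1]\<close> gives a solution.\<close>

section \<open>Young functions and their level points\<close>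

lemma young_function_convex:
  assumes "young_function f" "0 \<le> x" "0 \<le> y" "0 \<le> t" "t \<le> 1"
  shows "f ((1 - t) * x + t * y) \<le> ennreal (1 - t) * f x + ennreal t * f y"
  using assms unfolding young_function_def by auto

lemma young_function_0: "young_function f \<Longrightarrow> f 0 = 0"
  unfolding young_function_def by auto

lemma young_function_scale:
  assumes "young_function f" "0 \<le> x" "0 \<le> t" "t \<le> 1"
  shows "f (t * x) \<le> ennreal t * f x"
  using young_function_convex[OF assms(1) order_refl assms(2-4)] young_function_0[OF assms(1)]
  by simp

lemma young_function_mono:
  assumes f: "young_function f" and "0 \<le> x" "x \<le> y"
  shows "f x \<le> f y"
proof (cases "y = 0")
  case False
  then have y: "0 < y"
    using assms by auto
  have "f x = f ((x / y) * y)"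
    using y by simp
  also have "\<dots> \<le> ennreal (x / y) * f y"
    using assms y by (intro young_function_scale) auto
  also have "\<dots> \<le> 1 * f y"
    using assms y by (intro mult_right_mono) (auto simp: ennreal_le_1)
  finally show ?thesis
    by simp
qed (use assms in auto)

text \<open>A generalized inverse of \<open>f\<close>. For positive \<open>r\<close> the supremum is
  attained, see \<open>young_function_young_level_le\<close>.\<close>

definition young_level :: "(real \<Rightarrow> ennreal) \<Rightarrow> real \<Rightarrow> real" where
  "young_level f r = Sup {x. 0 \<le> x \<and> f x \<le> ennreal r}"

lemma young_level_bdd_above:
  assumes "young_function f"
  shows "bdd_above {x. 0 \<le> x \<and> f x \<le> ennreal r}"
proof -
  have "(f \<longlongrightarrow> \<infinity>) at_top"
    using assms unfolding young_function_def by auto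
  then have "eventually (\<lambda>x. ennreal r < f x) at_top"
    by (rule order_tendstoD) simp
  then obtain b where "\<And>x. x \<ge> b \<Longrightarrow> ennreal r < f x"
    unfolding eventually_at_top_linorder by auto
  then show ?thesis
    by (intro bdd_aboveI[of _ b]) (metis (mono_tags, lifting) leD linorder_le_cases mem_Collect_eq)
qed

lemma le_young_level:
  assumes "young_function f" "0 \<le> x" "f x \<le> ennreal r"
  shows "x \<le> young_level f r"
  unfolding young_level_def using assms by (intro cSup_upper young_level_bdd_above) auto

lemma young_level_pos:
  assumes f: "young_function f" and r: "0 < r"
  shows "0 < young_level f r"
proof -
  obtain x where x: "0 < x" "f x \<noteq> \<infinity>"
    using f unfolding young_function_def by auto
  obtain v where v: "f x = ennreal v" "0 \<le> v"
    using x by (cases "f x") auto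
  \<comment> \<open>The \<open>+ 1\<close> keeps \<open>t\<close> positive when
    \<open>v = 0\<close>.\<close>
  define t where "t = min 1 (r / (v + 1))"
  have t: "0 < t" "t \<le> 1"
    using r v by (auto simp: t_def)
  have "t * v \<le> r / (v + 1) * (v + 1)"
    using r v t by (intro mult_mono) (auto simp: t_def)
  then have tv: "t * v \<le> r"
    using v by simp
  have "f (t * x) \<le> ennreal t * f x"
    using f x t by (intro young_function_scale) auto
  also have "\<dots> = ennreal (t * v)"
    using v t by (simp add: ennreal_mult)
  also have "\<dots> \<le> ennreal r"
    using tv by (rule ennreal_leI)
  finally have "t * x \<le> young_level f r"
    using f x t by (intro le_young_level) auto
  moreover have "0 < t * x"
    using x t by simp
  ultimately show ?thesis
    by linarith
qed

text \<open>Every point of \<open>[0, young_level f r)\<close> has value at most \<open>r\<close>,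
  and left-continuity carries the bound to the endpoint.\<close>

lemma young_function_young_level_le:
  assumes f: "young_function f" and r: "0 < r"
  shows "f (young_level f r) \<le> ennreal r"
proof -
  let ?x = "young_level f r"
  have pos: "0 < ?x"
    using young_level_pos[OF f r] .
  have "(f \<longlongrightarrow> f ?x) (at_left ?x)"
    using f pos unfolding young_function_def continuous_within by auto
  moreover have "eventually (\<lambda>u. f u \<le> ennreal r) (at_left ?x)"
    unfolding eventually_at_left_field
  proof (intro exI[of _ 0] conjI pos allI impI)
    fix u assume u: "0 < u" "u < ?x"
    then obtain y where "y \<in> {x. 0 \<le> x \<and> f x \<le> ennreal r}" "u < y"
      using young_function_0[OF f] young_level_bdd_above[OF f, of r]
      unfolding young_level_def by (subst (asm) less_cSup_iff) (auto intro!: exI[of _ 0])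
    then show "f u \<le> ennreal r"
      using young_function_mono[OF f, of u y] u by auto
  qed
  ultimately show ?thesis
    by (intro tendsto_upperbound) (auto simp: trivial_limit_at_left_real)
qed

lemma young_level_mono:
  assumes f: "young_function f" and "0 < r" "r \<le> r'"
  shows "young_level f r \<le> young_level f r'"
proof (rule le_young_level[OF f])
  show "0 \<le> young_level f r"
    using young_level_pos[OF f] assms by (simp add: less_imp_le)
  show "f (young_level f r) \<le> ennreal r'"
    using young_function_young_level_le[OF f \<open>0 < r\<close>] ennreal_leI[OF \<open>r \<le> r'\<close>] by (rule order_trans)
qed

section \<open>Real-valued truncations\<close>

text \<open>Clamping the argument to the interval on which \<open>f \<le> 1\<close> turns \<open>f\<close> into a real function that
  is continuous everywhere, even if \<open>f\<close> jumps to \<open>\<infinity>\<close>.\<close>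

definition young_trunc :: "(real \<Rightarrow> ennreal) \<Rightarrow> real \<Rightarrow> real" where
  "young_trunc f u = enn2real (f (max 0 (min u (young_level f 1))))"

lemma young_function_le_1:
  assumes "young_function f" "0 \<le> u" "u \<le> young_level f 1"
  shows "f u \<le> 1"
  using young_function_mono[OF assms] young_function_young_level_le[OF assms(1), of 1] by simp

lemma ennreal_young_trunc:
  assumes "young_function f" "0 \<le> u" "u \<le> young_level f 1"
  shows "ennreal (young_trunc f u) = f u"
proof -
  have "f u < top"
    using young_function_le_1[OF assms] by (rule le_less_trans) simp
  then show ?thesis
    using assms by (simp add: young_trunc_def)
qed

lemma young_trunc_nonneg: "0 \<le> young_trunc f u"
  by (simp add: young_trunc_def)

lemma young_trunc_0: "young_function f \<Longrightarrow> young_trunc f 0 = 0"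
  using young_level_pos[of f 1] by (simp add: young_trunc_def young_function_0)

lemma convex_on_young_trunc:
  assumes f: "young_function f"
  shows "convex_on {0..young_level f 1} (young_trunc f)"
proof (rule convex_onI)
  fix t x y :: real
  assume t: "0 < t" "t < 1" and x: "x \<in> {0..young_level f 1}" and y: "y \<in> {0..young_level f 1}"
  let ?z = "(1 - t) * x + t * y"
  have z: "?z \<in> {0..young_level f 1}"
    using convexD_alt[of "{0..young_level f 1}" x y t] x y t by simp
  have "ennreal (young_trunc f ?z) = f ?z"
    using f z by (intro ennreal_young_trunc) auto
  also have "\<dots> \<le> ennreal (1 - t) * f x + ennreal t * f y"
    using f x y t by (intro young_function_convex) auto
  also have "\<dots> = ennreal ((1 - t) * young_trunc f x + t * young_trunc f y)"
    using t x y f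
    by (simp add: ennreal_mult ennreal_plus ennreal_young_trunc young_trunc_nonneg
        flip: ennreal_young_trunc)
  finally show "young_trunc f ((1 - t) *\<^sub>R x + t *\<^sub>R y) \<le> (1 - t) * young_trunc f x + t * young_trunc f y"
    using t by (subst (asm) ennreal_le_iff) (auto intro!: add_nonneg_nonneg mult_nonneg_nonneg young_trunc_nonneg)
qed auto

text \<open>Convexity gives continuity only inside the interval. At 0 the truncation is squeezed
  between 0 and the line \<open>u / ?x\<close>; at the right end left-continuity of \<open>f\<close>
  is used. Clamping extends the result to the whole line.\<close>

lemma continuous_on_young_trunc:
  assumes f: "young_function f"
  shows "continuous_on UNIV (young_trunc f)"
proof -
  let ?x = "young_level f 1" and ?h = "young_trunc f"
  have pos: "0 < ?x"
    using f by (rule young_level_pos) simp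
  have le1: "?h u \<le> 1" if "0 \<le> u" "u \<le> ?x" for u
  proof -
    have "ennreal (?h u) \<le> ennreal 1"
      using young_function_le_1[OF f that] ennreal_young_trunc[OF f that] by simp
    then show ?thesis
      by simp
  qed
  have "continuous_on {0<..<?x} ?h"
    by (intro convex_on_continuous convex_on_subset[OF convex_on_young_trunc[OF f]]) auto
  then have inner: "continuous (at u within {0..?x}) ?h" if "0 < u" "u < ?x" for u
    using that by (simp add: continuous_on_eq_continuous_at continuous_at_imp_continuous_at_within)
  have "((\<lambda>u. u / ?x) \<longlongrightarrow> 0 / ?x) (at 0 within {0..?x})"
    by (intro tendsto_intros) (use pos in auto)
  then have "((\<lambda>u. u / ?x) \<longlongrightarrow> 0) (at 0 within {0..?x})"
    by simp
  moreover have "?h u \<le> u / ?x" if u: "u \<in> {0..?x}" for u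
  proof -
    have "?h ((1 - u / ?x) *\<^sub>R 0 + (u / ?x) *\<^sub>R ?x) \<le> (1 - u / ?x) * ?h 0 + (u / ?x) * ?h ?x"
      using u pos by (intro convex_onD[OF convex_on_young_trunc[OF f]]) auto
    also have "\<dots> \<le> u / ?x * 1"
      using u pos le1[of ?x] by (simp add: young_trunc_0[OF f] divide_right_mono mult_left_le)
    finally show ?thesis
      using pos by simp
  qed
  then have "eventually (\<lambda>u. ?h u \<le> u / ?x) (at 0 within {0..?x})"
    by (simp add: eventually_at_filter)
  ultimately have "(?h \<longlongrightarrow> 0) (at 0 within {0..?x})"
    by (intro tendsto_sandwich[of "\<lambda>_. 0" ?h _ "\<lambda>u. u / ?x"]) (auto simp: young_trunc_nonneg)
  then have left: "continuous (at 0 within {0..?x}) ?h"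
    by (simp add: continuous_within young_trunc_0[OF f])
  have "(f \<longlongrightarrow> f ?x) (at_left ?x)"
    using f pos unfolding young_function_def continuous_within by auto
  then have "((\<lambda>u. enn2real (f u)) \<longlongrightarrow> ?h ?x) (at_left ?x)"
    using ennreal_young_trunc[OF f, of ?x] pos
    by (intro tendsto_enn2real) (auto simp: young_trunc_nonneg)
  moreover have "eventually (\<lambda>u. enn2real (f u) = ?h u) (at_left ?x)"
    unfolding eventually_at_left_field using pos
    by (intro exI[of _ 0]) (auto simp: young_trunc_def)
  ultimately have "(?h \<longlongrightarrow> ?h ?x) (at_left ?x)"
    by (rule Lim_transform_eventually)
  then have right: "continuous (at ?x within {0..?x}) ?h"
    using pos by (simp add: continuous_within at_within_Icc_at_left)
  have "continuous_on {0..?x} ?h"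
    unfolding continuous_on_eq_continuous_within
  proof
    fix u assume "u \<in> {0..?x}"
    then consider "u = 0" | "u = ?x" | "0 < u" "u < ?x"
      by force
    then show "continuous (at u within {0..?x}) ?h"
      using left right inner by cases auto
  qed
  then have "continuous_on UNIV (\<lambda>u. ?h (max 0 (min u ?x)))"
    by (rule continuous_on_compose2) (use pos in \<open>auto intro!: continuous_intros\<close>)
  moreover have "?h (max 0 (min u ?x)) = ?h u" for u
    using pos by (simp add: young_trunc_def)
  ultimately show ?thesis
    by simp
qed

text \<open>Just to the right of the level \<open>f\<close> exceeds \<open>r\<close>. These points
  still lie below level 1, where the truncation agrees with \<open>f\<close> and is continuous, so
  \<open>f\<close> cannot have jumped over \<open>r\<close>.\<close>

lemma young_trunc_young_level:
  assumes f: "young_function f" and r: "0 < r" and less: "young_level f r < young_level f 1"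
  shows "young_trunc f (young_level f r) = r"
proof (rule antisym)
  let ?a = "young_level f r" and ?x = "young_level f 1" and ?h = "young_trunc f"
  have a: "0 < ?a"
    using young_level_pos[OF f r] .
  have "ennreal (?h ?a) \<le> ennreal r"
    using young_function_young_level_le[OF f r] ennreal_young_trunc[OF f, of ?a] a less by simp
  then show "?h ?a \<le> r"
    using r by simp
  show "r \<le> ?h ?a"
  proof (rule tendsto_lowerbound)
    have "continuous (at ?a) ?h"
      using continuous_on_young_trunc[OF f] by (simp add: continuous_on_eq_continuous_at)
    then show "(?h \<longlongrightarrow> ?h ?a) (at_right ?a)"
      by (simp add: continuous_at filterlim_at_split)
    show "eventually (\<lambda>u. r \<le> ?h u) (at_right ?a)"
      unfolding eventually_at_right_field
    proof (intro exI[of _ ?x] conjI less allI impI)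
      fix u assume u: "?a < u" "u < ?x"
      then have "\<not> f u \<le> ennreal r"
        using le_young_level[OF f, of u r] a by auto
      then have "\<not> ennreal (?h u) \<le> ennreal r"
        using ennreal_young_trunc[OF f, of u] a u by simp
      then show "r \<le> ?h u"
        using ennreal_leI[of "?h u" r] by linarith
    qed
  qed simp
qed

section \<open>Existence of the additional point\<close>

text \<open>Both \<open>t\<close> and \<open>a + s\<close> lie between \<open>s\<close> and
  \<open>a + t\<close>, and they are convex combinations of these endpoints with interchanged
  weights. Adding the two convexity inequalities gives the claim.\<close>

lemma convex_on_diff_mono:
  fixes h :: "real \<Rightarrow> real"
  assumes h: "convex_on {0..b} h" and a: "0 \<le> a" and s: "0 \<le> s" "s \<le> t" and t: "a + t \<le> b"
  shows "h (a + s) - h s \<le> h (a + t) - h t"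
proof (cases "a + t = s")
  case False
  define d where "d = a + t - s"
  have d: "0 < d"
    using False a s by (auto simp: d_def)
  define p where "p = (t - s) / d"
  have p: "0 \<le> p" "p \<le> 1" and pd: "p * d = t - s"
    using a s d by (auto simp: p_def d_def)
  have 1: "h ((1 - p) *\<^sub>R s + p *\<^sub>R (a + t)) \<le> (1 - p) * h s + p * h (a + t)"
    using p a s t by (intro convex_onD[OF h]) auto
  have 2: "h ((1 - (1 - p)) *\<^sub>R s + (1 - p) *\<^sub>R (a + t)) \<le> (1 - (1 - p)) * h s + (1 - p) * h (a + t)"
    using p a s t by (intro convex_onD[OF h]) auto
  have e1: "(1 - p) *\<^sub>R s + p *\<^sub>R (a + t) = t"
    using pd by (simp add: d_def algebra_simps)
  have e2: "(1 - (1 - p)) *\<^sub>R s + (1 - p) *\<^sub>R (a + t) = a + s"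
    using pd by (simp add: d_def algebra_simps)
  show ?thesis
    using 1 2 unfolding e1 e2 by (simp add: algebra_simps)
next
  case True
  then show ?thesis
    using a s by auto
qed

text \<open>For given \<open>c\<close> the admissible \<open>s\<close> need not be unique, so a solution is not found along a path in
  \<open>c\<close>. Instead, the \<open>c\<close> admitting some \<open>s\<close> whose sum is at most, respectively at least, \<open>1 - c\<close> form
  two closed sets covering the interval. At a common point, the intermediate value theorem applies
  on the segment between the two \<open>s\<close>, which by monotonicity consists of admissible points.\<close>

lemma balanced_point:
  fixes G \<phi> :: "'n::finite \<Rightarrow> real \<Rightarrow> real" and E :: "'n \<Rightarrow> real"
  assumes G: "\<And>i. continuous_on UNIV (G i)" and \<phi>: "\<And>i. continuous_on UNIV (\<phi> i)"
    and mono: "\<And>i s t. 0 \<le> s \<Longrightarrow> s \<le> t \<Longrightarrow> t \<le> E i \<Longrightarrow> G i s \<le> G i t"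
    and E: "\<And>i. 0 \<le> E i"
    and \<phi>_nonneg: "\<And>i s. 0 \<le> \<phi> i s" and \<phi>_0: "\<And>i. \<phi> i 0 = 0"
    and G0: "\<And>i. G i 0 \<le> c0" "\<And>i. G i 0 = c0 \<or> E i = 0"
    and c0: "c0 \<le> 1"
  obtains c s where "c0 \<le> c" "\<And>i. 0 \<le> s i" "\<And>i. s i \<le> E i" "\<And>i. G i (s i) \<le> c"
    "\<And>i. G i (s i) = c \<or> s i = E i" "(\<Sum>i\<in>UNIV. \<phi> i (s i)) = 1 - c"
proof -
  define bal :: "real \<Rightarrow> real ^ 'n \<Rightarrow> bool" where
    "bal c s \<longleftrightarrow> (\<forall>i. (0 \<le> s $ i \<and> s $ i \<le> E i) \<and> G i (s $ i) \<le> c \<and> (G i (s $ i) = c \<or> s $ i = E i))"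
    for c s
  define P where "P s = (\<Sum>i\<in>UNIV. \<phi> i (s $ i))" for s :: "real ^ 'n"
  have P_cont: "continuous_on X (\<lambda>x. P (g x))" if "continuous_on X g"
    for X :: "'b::topological_space set" and g
    unfolding P_def
    by (intro continuous_on_sum continuous_on_compose2[OF \<phi>] continuous_intros that) auto
  \<comment> \<open>\<open>F\<close> pairs each \<open>c\<close> in \<open>{c0..1}\<close> with its
    admissible vectors. The box bounds make it compact, so the projections \<open>L\<close> and
    \<open>U\<close> are closed.\<close>
  define F where "F = {p. c0 \<le> fst p \<and> fst p \<le> 1 \<and> bal (fst p) (snd p)}"
  have "closed {p::real \<times> (real ^ 'n). bal (fst p) (snd p)}"
    unfolding bal_def
    by (intro closed_Collect_all closed_Collect_conj closed_Collect_disj closed_Collect_le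
        closed_Collect_eq continuous_intros continuous_on_compose2[OF G]) auto
  moreover have "F = ({c0..1} \<times> cbox 0 (\<chi> i. E i)) \<inter> {p. bal (fst p) (snd p)}"
    by (auto simp: F_def bal_def mem_box_cart)
  ultimately have F: "compact F"
    by (auto intro!: compact_Int_closed compact_Times)
  define L where "L = fst ` (F \<inter> {p. P (snd p) \<le> 1 - fst p})"
  define U where "U = fst ` (F \<inter> {p. 1 - fst p \<le> P (snd p)})"
  have "compact L" "compact U"
    unfolding L_def U_def
    by (intro compact_continuous_image compact_Int_closed F closed_Collect_le P_cont continuous_intros)+
  then have closed: "closed L" "closed U"
    by (simp_all add: compact_imp_closed)
  \<comment> \<open>Each coordinate is solved separately: \<open>E i\<close> itself works, or
    \<open>G i\<close> passes \<open>c\<close> between 0 and \<open>E i\<close>.\<close>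
  have bal_ex: "\<exists>s. bal c s" if "c0 \<le> c" for c
  proof -
    have "\<exists>s. (0 \<le> s \<and> s \<le> E i) \<and> G i s \<le> c \<and> (G i s = c \<or> s = E i)" for i
    proof (cases "G i (E i) \<le> c")
      case True
      then show ?thesis
        using E by blast
    next
      case False
      then have "\<exists>s\<ge>0. s \<le> E i \<and> G i s = c"
        using G0(1)[of i] that E[of i] by (intro IVT' continuous_on_subset[OF G]) auto
      then show ?thesis
        by auto
    qed
    then obtain s where "\<And>i. (0 \<le> s i \<and> s i \<le> E i) \<and> G i (s i) \<le> c \<and> (G i (s i) = c \<or> s i = E i)"
      by metis
    then have "bal c (\<chi> i. s i)"
      by (simp add: bal_def)
    then show ?thesis
      by blast
  qed
  have "{c0..1} \<subseteq> L \<union> U"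
  proof
    fix c assume c: "c \<in> {c0..1}"
    then obtain s where s: "bal c s"
      using bal_ex by auto
    then have "(c, s) \<in> F"
      using c by (simp add: F_def)
    then show "c \<in> L \<union> U"
      unfolding L_def U_def by (cases "P s \<le> 1 - c") (force intro!: image_eqI[of c fst "(c, s)"])+
  qed
  \<comment> \<open>At \<open>c0\<close> the zero vector is admissible, with sum \<open>0\<close>,
    which is at most \<open>1 - c0\<close>.\<close>
  moreover have "c0 \<in> L"
  proof -
    have "bal c0 0"
      using G0 E by (auto simp: bal_def)
    then show ?thesis
      unfolding L_def using c0
      by (intro image_eqI[of c0 fst "(c0, 0)"]) (auto simp: F_def P_def \<phi>_0)
  qed
  \<comment> \<open>At \<open>c = 1\<close> the target sum is 0, and every admissible vector has a
    nonnegative sum.\<close>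
  moreover have "1 \<in> U"
  proof -
    obtain s where "bal 1 s"
      using bal_ex c0 by auto
    then show ?thesis
      unfolding U_def using c0
      by (intro image_eqI[of 1 fst "(1, s)"]) (auto simp: F_def P_def \<phi>_nonneg sum_nonneg)
  qed
  ultimately have "L \<inter> U \<inter> {c0..1} \<noteq> {}"
    using connected_closedD[OF connected_Icc[of c0 1], of L U] closed c0
      disjoint_iff[of L "{c0..1}"] disjoint_iff[of U "{c0..1}"] by auto
  then obtain c l u where c: "c0 \<le> c" and l: "bal c l" "P l \<le> 1 - c" and u: "bal c u" "1 - c \<le> P u"
    unfolding L_def U_def F_def by auto
  have "\<exists>t\<ge>0. t \<le> 1 \<and> P (l + t *\<^sub>R (u - l)) = 1 - c"
    using l u by (intro IVT' P_cont continuous_intros) auto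
  then obtain t where t: "0 \<le> t" "t \<le> 1" "P (l + t *\<^sub>R (u - l)) = 1 - c"
    by auto
  define s where "s i = l $ i + t * (u $ i - l $ i)" for i
  have s: "(0 \<le> s i \<and> s i \<le> E i) \<and> G i (s i) \<le> c \<and> (G i (s i) = c \<or> s i = E i)" for i
  proof -
    \<comment> \<open>If \<open>G i p = c\<close>, monotonicity and \<open>G i q\<close> \<le>
      \<open>c\<close> force \<open>G i\<close> to be constantly \<open>c\<close> on
      \<open>{p..q}\<close>. If \<open>p = E i\<close>, the interval is a single point.\<close>
    define p q where "p = min (l $ i) (u $ i)" and "q = max (l $ i) (u $ i)"
    have pq: "0 \<le> p" "q \<le> E i" "G i q \<le> c" "G i p = c \<or> p = E i"
      using l(1) u(1) unfolding bal_def p_def q_def min_def max_def by force+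
    have s: "s i \<in> {p..q}"
    proof -
      have "s i = (1 - t) *\<^sub>R (l $ i) + t *\<^sub>R (u $ i)"
        by (simp add: s_def algebra_simps)
      also have "\<dots> \<in> {p..q}"
        using t by (intro convexD_alt) (auto simp: p_def q_def)
      finally show ?thesis .
    qed
    then show ?thesis
      using pq mono[of p "s i" i] mono[of "s i" q i] by force
  qed
  show thesis
  proof (rule that[OF c])
    show "(\<Sum>i\<in>UNIV. \<phi> i (s i)) = 1 - c"
      using t(3) by (simp add: P_def s_def)
  qed (use s in blast)+
qed

section \<open>Vectors of Luxemburg norm 1\<close>

text \<open>Suppose \<open>w = l *\<^sub>R v\<close> with \<open>l < 1\<close> and \<open>v\<close>
  in the ball. Convexity then bounds the sum for \<open>w\<close> by \<open>l\<close>, which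
  excludes the value 1. A coordinate of \<open>w\<close> at level 1 would push that of
  \<open>v\<close> beyond the last point where \<open>f k\<close> \<le> 1. The second alternative
  covers sums below 1, which occur when some \<open>f k\<close> jumps to infinity.\<close>

lemma luxemburg_norm_eq_1:
  fixes f :: "'n::finite \<Rightarrow> real \<Rightarrow> ennreal"
  assumes f: "\<And>i. young_function (f i)"
    and le: "(\<Sum>i\<in>UNIV. f i \<bar>w $ i\<bar>) \<le> 1"
    and bdry: "(\<Sum>i\<in>UNIV. f i \<bar>w $ i\<bar>) = 1 \<or> (\<exists>k. \<bar>w $ k\<bar> = young_level (f k) 1)"
  shows "luxemburg_norm f w = 1"
  unfolding luxemburg_norm_def
proof (rule cInf_eq_minimum)
  show "1 \<in> {l. 0 < l \<and> w \<in> (*\<^sub>R) l ` musielak_orlicz_ball f}"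
    using le by (auto simp: musielak_orlicz_ball_def)
next
  fix l assume "l \<in> {l. 0 < l \<and> w \<in> (*\<^sub>R) l ` musielak_orlicz_ball f}"
  then obtain v where l: "0 < l" and w: "w = l *\<^sub>R v" and v: "(\<Sum>i\<in>UNIV. f i \<bar>v $ i\<bar>) \<le> 1"
    by (auto simp: musielak_orlicz_ball_def)
  have abs_w: "\<bar>w $ i\<bar> = l * \<bar>v $ i\<bar>" for i
    using l by (simp add: w abs_mult)
  show "1 \<le> l"
  proof (rule ccontr)
    assume "\<not> 1 \<le> l"
    then have l1: "l < 1"
      by simp
    from bdry show False
    proof
      assume "(\<Sum>i\<in>UNIV. f i \<bar>w $ i\<bar>) = 1"
      then have "1 = (\<Sum>i\<in>UNIV. f i \<bar>w $ i\<bar>)"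
        by simp
      also have "(\<Sum>i\<in>UNIV. f i \<bar>w $ i\<bar>) \<le> (\<Sum>i\<in>UNIV. ennreal l * f i \<bar>v $ i\<bar>)"
        unfolding abs_w using l l1 by (intro sum_mono young_function_scale f) auto
      also have "\<dots> = ennreal l * (\<Sum>i\<in>UNIV. f i \<bar>v $ i\<bar>)"
        by (simp add: sum_distrib_left)
      also have "\<dots> \<le> ennreal l * 1"
        using v by (intro mult_left_mono) auto
      also have "\<dots> < 1"
        using l1 by (simp add: ennreal_less_one_iff)
      finally show False
        by simp
    next
      assume "\<exists>k. \<bar>w $ k\<bar> = young_level (f k) 1"
      then obtain k where k: "\<bar>w $ k\<bar> = young_level (f k) 1"
        by auto
      have "f k \<bar>v $ k\<bar> \<le> (\<Sum>i\<in>UNIV. f i \<bar>v $ i\<bar>)"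
        by (rule member_le_sum) auto
      then have "\<bar>v $ k\<bar> \<le> l * \<bar>v $ k\<bar>"
        using v le_young_level[OF f, of "\<bar>v $ k\<bar>" k 1] k abs_w[of k] by simp
      moreover have "0 < l * \<bar>v $ k\<bar>"
        using young_level_pos[OF f, of 1 k] k abs_w[of k] by simp
      ultimately show False
        using l l1 by (simp add: zero_less_mult_iff)
    qed
  qed
qed

section \<open>The equilateral set\<close>

theorem theorem1p7:
  fixes f :: "'n::finite \<Rightarrow> real \<Rightarrow> ennreal"
  assumes "\<And>i. young_function (f i)"
  shows "equilateral_dim (luxemburg_norm f) \<ge> enat (CARD('n) + 1)"
proof -
  note f = assms
  define x where "x i = young_level (f i) 1" for i
  define a where "a i = young_level (f i) (1/2)" for i
  define h where "h i = young_trunc (f i)" for i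
  have a: "0 < a i" "a i \<le> x i" for i
    unfolding a_def x_def by (simp_all add: young_level_pos young_level_mono f)
  have h: "ennreal (h i u) = f i u" if "0 \<le> u" "u \<le> x i" for i u
    using that unfolding h_def x_def by (intro ennreal_young_trunc f)
  have h_nonneg: "0 \<le> h i u" and h_0: "h i 0 = 0" for i u
    by (simp_all add: h_def young_trunc_nonneg young_trunc_0 f)
  have h_cont: "continuous_on UNIV (h i)" for i
    unfolding h_def by (intro continuous_on_young_trunc f)
  have h_a: "h i (a i) \<le> 1/2" for i
  proof -
    have "ennreal (h i (a i)) \<le> ennreal (1/2)"
      using young_function_young_level_le[OF f, of "1/2" i] a[of i] h[of "a i" i]
      by (simp add: a_def)
    then show ?thesis
      by (subst (asm) ennreal_le_iff) auto
  qed
  have h_a_eq: "h i (a i) = 1/2 \<or> a i = x i" for i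
    using young_trunc_young_level[OF f, of "1/2" i] a(2)[of i]
    unfolding h_def a_def x_def by fastforce
  obtain c s where c: "1/2 \<le> c" and s: "\<And>i. 0 \<le> s i" "\<And>i. s i \<le> x i - a i"
    and G: "\<And>i. h i (a i + s i) - h i (s i) \<le> c"
      "\<And>i. h i (a i + s i) - h i (s i) = c \<or> s i = x i - a i"
    and sum: "(\<Sum>i\<in>UNIV. h i (s i)) = 1 - c"
  \<comment> \<open>The start value \<open>1/2\<close> fits because \<open>h i (a i) = 1/2\<close>
    unless \<open>a i = x i\<close>, and then the range \<open>x i - a i\<close> of
    \<open>s i\<close> is zero.\<close>
  proof (rule balanced_point[of "\<lambda>i s. h i (a i + s) - h i s" h "\<lambda>i. x i - a i" "1/2"])
    show "continuous_on UNIV (\<lambda>s. h i (a i + s) - h i s)" for i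
      by (intro continuous_intros continuous_on_compose2[OF h_cont]) auto
    show "h i (a i + s) - h i s \<le> h i (a i + t) - h i t"
      if "0 \<le> s" "s \<le> t" "t \<le> x i - a i" for i s t
      using that a[of i] unfolding h_def x_def
      by (intro convex_on_diff_mono[OF convex_on_young_trunc[OF f]]) auto
    show "h i (a i + 0) - h i 0 = 1/2 \<or> x i - a i = 0" for i
      using h_a_eq[of i] h_0[of i] by auto
  qed (use h_cont a h_nonneg h_0 h_a in auto)
  define z where "z i = axis i (a i)" for i
  \<comment> \<open>The minus sign makes the entries add up: \<open>z i - y\<close> has absolute
    entries \<open>a i + s i\<close> at \<open>i\<close> and \<open>s k\<close> elsewhere.\<close>
  define y where "y = (\<chi> i. - s i)"
  define N where "N = luxemburg_norm f"
  have N1: "N w = 1"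
    if "\<And>i. \<bar>w $ i\<bar> \<le> x i" and "(\<Sum>i\<in>UNIV. h i \<bar>w $ i\<bar>) \<le> 1"
      and "(\<Sum>i\<in>UNIV. h i \<bar>w $ i\<bar>) = 1 \<or> (\<exists>k. \<bar>w $ k\<bar> = x k)" for w
  proof -
    have "(\<Sum>i\<in>UNIV. f i \<bar>w $ i\<bar>) = (\<Sum>i\<in>UNIV. ennreal (h i \<bar>w $ i\<bar>))"
      using that(1) by (intro sum.cong) (auto simp: h)
    also have "\<dots> = ennreal (\<Sum>i\<in>UNIV. h i \<bar>w $ i\<bar>)"
      by (simp add: h_nonneg)
    finally have "(\<Sum>i\<in>UNIV. f i \<bar>w $ i\<bar>) = ennreal (\<Sum>i\<in>UNIV. h i \<bar>w $ i\<bar>)" .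
    then show ?thesis
      unfolding N_def using that(2,3) by (intro luxemburg_norm_eq_1 f) (auto simp: x_def ennreal_le_1)
  qed
  have zz: "N (z i - z j) = 1" if ij: "i \<noteq> j" for i j
  proof -
    have w: "\<bar>(z i - z j) $ k\<bar> = (if k = i then a i else if k = j then a j else 0)" for k
      using ij a[of i] a[of j] by (auto simp: z_def axis_def)
    note [simp del] = vector_minus_component
    have "(\<Sum>k\<in>UNIV. h k \<bar>(z i - z j) $ k\<bar>) = (\<Sum>k\<in>{i, j}. h k \<bar>(z i - z j) $ k\<bar>)"
      by (rule sum.mono_neutral_right) (auto simp: w h_0)
    also have "\<dots> = h i (a i) + h j (a j)"
      using ij by (simp add: w)
    finally have sm: "(\<Sum>k\<in>UNIV. h k \<bar>(z i - z j) $ k\<bar>) = h i (a i) + h j (a j)" .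
    show ?thesis
    proof (rule N1)
      show "\<bar>(z i - z j) $ k\<bar> \<le> x k" for k
        using a[of k] by (auto simp: w)
      show "(\<Sum>k\<in>UNIV. h k \<bar>(z i - z j) $ k\<bar>) \<le> 1"
        unfolding sm using h_a[of i] h_a[of j] by simp
      show "(\<Sum>k\<in>UNIV. h k \<bar>(z i - z j) $ k\<bar>) = 1 \<or> (\<exists>k. \<bar>(z i - z j) $ k\<bar> = x k)"
        unfolding sm using h_a_eq[of i] h_a_eq[of j] w[of i] w[of j] ij by force
    qed
  qed
  have zy: "N (z i - y) = 1" "N (y - z i) = 1" for i
  proof -
    have w: "\<bar>(z i - y) $ k\<bar> = (if k = i then a i + s i else s k)" for k
      using s[of k] a[of k] by (auto simp: z_def y_def axis_def)
    note [simp del] = vector_minus_component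
    have "(\<Sum>k\<in>UNIV. h k \<bar>(z i - y) $ k\<bar>) = h i (a i + s i) + (\<Sum>k\<in>UNIV - {i}. h k (s k))"
      by (subst sum.remove[of _ i]) (auto simp: w)
    also have "(\<Sum>k\<in>UNIV - {i}. h k (s k)) = (\<Sum>k\<in>UNIV. h k (s k)) - h i (s i)"
      by (simp add: sum.remove[of UNIV i])
    \<comment> \<open>Passing from \<open>s\<close> to \<open>z i - y\<close> changes only the
      summand at \<open>i\<close>, so the sum is 1 exactly when the increment at \<open>i\<close>
      equals \<open>c\<close>. Otherwise \<open>a i + s i = x i\<close>.\<close>
    finally have sm: "(\<Sum>k\<in>UNIV. h k \<bar>(z i - y) $ k\<bar>) = 1 - c + (h i (a i + s i) - h i (s i))"
      using sum by simp
    have bd: "\<bar>(z i - y) $ k\<bar> \<le> x k" for k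
      using s[of k] a[of k] by (auto simp: w)
    have le: "(\<Sum>k\<in>UNIV. h k \<bar>(z i - y) $ k\<bar>) \<le> 1"
      unfolding sm using G(1)[of i] by simp
    have bdry: "(\<Sum>k\<in>UNIV. h k \<bar>(z i - y) $ k\<bar>) = 1 \<or> (\<exists>k. \<bar>(z i - y) $ k\<bar> = x k)"
      unfolding sm using G(2)[of i] w[of i] by force
    show "N (z i - y) = 1"
      using bd le bdry by (rule N1)
    have "\<bar>(y - z i) $ k\<bar> = \<bar>(z i - y) $ k\<bar>" for k
      by (simp add: vector_minus_component)
    then show "N (y - z i) = 1"
      using bd le bdry by (intro N1) (simp_all only:)
  qed
  let ?S = "insert y (range z)"
  have "equilateral N ?S"
    unfolding equilateral_def using zz zy by (intro exI[of _ 1]) (auto; metis)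
  moreover have "card ?S = CARD('n) + 1"
  proof -
    have "inj z"
      by (rule injI) (metis a(1) axis_eq_axis less_irrefl z_def)
    moreover have "y \<notin> range z"
    proof
      assume "y \<in> range z"
      then obtain i where "y = z i"
        by auto
      then have "y $ i = z i $ i"
        by simp
      then show False
        using s(1)[of i] a(1)[of i] by (simp add: y_def z_def axis_def)
    qed
    ultimately show ?thesis
      by (simp add: card_image)
  qed
  ultimately show ?thesis
    unfolding equilateral_dim_def N_def
    by (intro SUP_upper2[of ?S]) (auto simp del: card_insert_disjoint)
qed

end
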